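(* Let $X$ be a Euclidean space with Lebesgue measure $\lambda$, let $r>0$ and $c\in(0,1)$. Let $K:X\times X\to\mathbb{R}_+$ be a Carathéodory kernel and let $N:X\times\mathbb{R}_+\to\mathbb{R}_+$ be the nonlinearity of the Hammerstein operator $\mathscr{H}:C^b(X,\mathbb{R}_+)\to\mathcal{C}(r,c)$ defined by $$(\mathscr{H}f)(x):=\int_X K(x,y)\,N(y,f(y))\,d\lambda(y).$$ Assume that: (N1) for every $z\in\mathbb{R}_+$ the function $N(\cdot,z)$ is measurable; (N2) for every $z_*\in\mathbb{R}_+$ and $\varepsilon>0$ there exists $\delta>0$ such that for a.e. $y\in X$ and every $z\in\mathbb{R}_+$, $|z-z_*|\le\delta$ implies $|N(y,z)-N(y,z_* )|\le\varepsilon$; (K1) for a.e. $y\in X$ we have $K(\cdot,y)\in\mathcal{C}(r,c)$; (K2) there exists a continuous function $\zeta:X\times\mathbb{R}_+\to\mathbb{R}_+$, nondecreasing in the second variable, such that $N(y,z)\le\zeta(y,z)$ for every $y\in X$, $z\in\mathbb{R}_+$, and there is $R\in(0,\infty)$ satisfying $$\sup_{x\in X}\int_X K(x,y)\,\zeta(y,R)\,d\lambda(y)=R;$$ (H) there exists $q\in(0,1)$ such that for every $\mathcal{F}\subset B(0,R)\cap\mathcal{C}(r,c)$ (with $R$ as in (K2)) we have $\chi_0(\mathscr{H}(\mathcal{F}))\le q\,\chi_0(\mathcal{F})$. Then $\mathscr{H}$ has a fixed point.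
   Context: $\mathbb{R}_+=[0,\infty)$. $C^b(X,\mathbb{R}_+)$ is the set of bounded continuous functions $X\to\mathbb{R}_+$, with the supremum norm $\|\cdot\|$ of $C^b(X,\mathbb{R})$; $B(0,R)$ is the open ball in that norm. The cone is $$\mathcal{C}(r,c)=\Big\{f\in C^b(X,\mathbb{R}_+):\ \inf_{\|x\|\le r}f(x)\ge c\|f\|\Big\}.$$ Carathéodory kernel: a function $K:X\times X\to\mathbb{R}_+$ such that (Car1) $K(x,\cdot)$ is measurable for every $x\in X$; (Car2) $K(\cdot,y)$ is continuous for a.e. $y\in X$; (Car3) for every $x_*\in X$ there exist an open neighbourhood $U_{x_*}$ of $x_*$ and a function $D_{x_*}\in L^1(X)$ such that $|K(x,y)|\le D_{x_*}(y)$ for every $x\in U_{x_*}$ and a.e. $y\in X$; (Car4) $\sup_{x\in X}\int_X|K(x,y)|\,d\lambda(y)<\infty$. Functional $\chi_0$: fix a saturating sequence $(S_n)_{n\in\mathbb{N}}$ for $X$, that is, an ascending sequence of compact sets whose union is $X$. For a bounded family $\mathcal{F}\subset C^b(X,\mathbb{R})$, $n\in\mathbb{N}$, $\varepsilon>0$ let $$\chi^n(\mathcal{F},\varepsilon):=\sup\Big\{\sup_{x\in X}|f(x)-g(x)|:\ f,g\in\mathcal{F},\ \sup_{x\in S_n}|f(x)-g(x)|\le\varepsilon\Big\}$$ (with $\sup\emptyset=0$), $\chi^n_0(\mathcal{F}):=\lim_{\varepsilon\to0}\chi^n(\mathcal{F},\varepsilon)$ and $\chi_0(\mathcal{F}):=\lim_{n\to\infty}\chi_0^n(\mathcal{F})$.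 (These limits exist by monotonicity.) *)

theory Defs
  imports "HOL-Analysis.Analysis"
begin

definition bcontfun_nonneg :: "('a::topological_space \<Rightarrow>\<^sub>C real) set" where
  "bcontfun_nonneg = {f. \<forall>x. 0 \<le> apply_bcontfun f x}"

definition bcontfun_cone :: "real \<Rightarrow> real \<Rightarrow> ('a::real_normed_vector \<Rightarrow>\<^sub>C real) set" where
  "bcontfun_cone r c = {f \<in> bcontfun_nonneg. (INF x\<in>{x. norm x \<le> r}. apply_bcontfun f x) \<ge> c * norm f}"

definition caratheodory_kernel :: "('a::euclidean_space \<Rightarrow> 'a \<Rightarrow> real) \<Rightarrow> bool" where
  "caratheodory_kernel K \<longleftrightarrow>
     (\<forall>x y. 0 \<le> K x y) \<and>
     (\<forall>x. K x \<in> borel_measurable lebesgue) \<and>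
     (AE y in lebesgue. continuous_on UNIV (\<lambda>x. K x y)) \<and>
     (\<forall>x0. \<exists>U D. open U \<and> x0 \<in> U \<and> integrable lebesgue D \<and>
        (\<forall>x\<in>U. AE y in lebesgue. \<bar>K x y\<bar> \<le> D y)) \<and>
     (SUP x. \<integral>\<^sup>+y. ennreal \<bar>K x y\<bar> \<partial>lebesgue) < \<infinity>"

definition saturating_sequence :: "(nat \<Rightarrow> 'a::topological_space set) \<Rightarrow> bool" where
  "saturating_sequence S \<longleftrightarrow> (\<forall>n. compact (S n)) \<and> incseq S \<and> (\<Union>n. S n) = UNIV"

text \<open>The suprema are taken in \<^typ>\<open>ennreal\<close>, where the supremum of the empty set is 0
  (relevant if the family, or some \<open>S n\<close>, is empty); on bounded families all values are finite.\<close>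

definition chi_eps ::
  "(nat \<Rightarrow> 'a::topological_space set) \<Rightarrow> nat \<Rightarrow> ('a \<Rightarrow>\<^sub>C real) set \<Rightarrow> real \<Rightarrow> ennreal" where
  "chi_eps S n F \<epsilon> =
     Sup {(SUP x. ennreal \<bar>apply_bcontfun f x - apply_bcontfun g x\<bar>) | f g.
            f \<in> F \<and> g \<in> F \<and>
            (SUP x\<in>S n. ennreal \<bar>apply_bcontfun f x - apply_bcontfun g x\<bar>) \<le> ennreal \<epsilon>}"

definition chi0_at ::
  "(nat \<Rightarrow> 'a::topological_space set) \<Rightarrow> nat \<Rightarrow> ('a \<Rightarrow>\<^sub>C real) set \<Rightarrow> ennreal" where
  "chi0_at S n F = Lim (at_right 0) (chi_eps S n F)"

definition chi0 :: "(nat \<Rightarrow> 'a::topological_space set) \<Rightarrow> ('a \<Rightarrow>\<^sub>C real) set \<Rightarrow> ennreal" where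
  "chi0 S F = lim (\<lambda>n. chi0_at S n F)"

end

theory Submission
  imports Defs "HOL-Complex_Analysis.Great_Picard"
begin

text \<open>Let \<open>B\<close> be the set of continuous functions with values in \<open>[0, R]\<close>, which \<open>H\<close> maps into itself.
  The operator \<open>H\<close> is uniformly continuous on \<open>B\<close> for the supremum norm, continuous on \<open>B\<close> for
  pointwise convergence, and \<open>H ` B\<close> is equicontinuous at every point. So \<open>H\<close> is a compact map for
  locally uniform convergence, and a Schauder--Tychonoff argument applies: Kuhn's
  combinatorial lemma on a finite-dimensional cube together with a partition of unity yields \<open>f n \<in> B\<close> such that \<open>f n - H (f n)\<close> tends to 0 pointwise, and a
  subsequence converges to a fixed point by the Arzela--Ascoli argument.\<close>

section \<open>Approximate Brouwer fixed points on a finite-dimensional cube\<close>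

text \<open>Kuhn's lemma on a fine grid gives a cell in which, for every coordinate, one vertex is
  not moved down by \<open>F\<close> and another is not moved up; uniform continuity then makes
  \<open>g q\<close> almost fixed. The dimension \<open>m\<close> will vary with the accuracy, so
  points are functions on \<open>nat\<close> of which only the first \<open>m\<close> values
  count.\<close>

lemma approximate_brouwer_cube:
  fixes F :: "(nat \<Rightarrow> real) \<Rightarrow> nat \<Rightarrow> real" and m :: nat and R :: real
  defines "cube \<equiv> {a. \<forall>i<m. 0 \<le> a i \<and> a i \<le> R}"
  assumes R: "0 \<le> R"
    and F: "\<And>a. a \<in> cube \<Longrightarrow> F a \<in> cube"
    and uc: "\<And>\<epsilon>. 0 < \<epsilon> \<Longrightarrow> \<exists>\<delta>>0. \<forall>a\<in>cube. \<forall>b\<in>cube.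
               (\<forall>i<m. \<bar>a i - b i\<bar> \<le> \<delta>) \<longrightarrow> (\<forall>i<m. \<bar>F a i - F b i\<bar> \<le> \<epsilon>)"
    and \<epsilon>: "0 < \<epsilon>"
  shows "\<exists>a\<in>cube. \<forall>i<m. \<bar>F a i - a i\<bar> \<le> \<epsilon>"
proof -
  obtain \<delta> where \<delta>: "0 < \<delta>" and F_close:
    "\<And>a b i. a \<in> cube \<Longrightarrow> b \<in> cube \<Longrightarrow> (\<And>j. j < m \<Longrightarrow> \<bar>a j - b j\<bar> \<le> \<delta>) \<Longrightarrow> i < m
      \<Longrightarrow> \<bar>F a i - F b i\<bar> \<le> \<epsilon> / 2"
    using uc[of "\<epsilon> / 2"] \<epsilon> by (metis half_gt_zero)
  \<comment> \<open>The mesh is at most \<open>\<delta>\<close> to control \<open>F\<close> across a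
    cell, and at most \<open>\<epsilon> / 2\<close> to absorb the distance from \<open>g q\<close>
    to the vertex \<open>g s\<close> in the upper estimate.\<close>
  define \<eta> where "\<eta> = min \<delta> (\<epsilon> / 2)"
  have \<eta>: "0 < \<eta>" "\<eta> \<le> \<delta>" "\<eta> \<le> \<epsilon> / 2"
    using \<delta> \<epsilon> by (auto simp: \<eta>_def)
  obtain p :: nat where p: "0 < p" "R / p \<le> \<eta>"
  proof -
    obtain p :: nat where "R / \<eta> < p"
      using reals_Archimedean2 by blast
    moreover have "0 \<le> R / \<eta>"
      using R \<eta>(1) by simp
    ultimately have "R / \<eta> < p" "0 < real p"
      by linarith+
    then show ?thesis
      using that[of p] \<eta>(1) by (simp add: field_simps)
  qed
  define g where "g x = (\<lambda>i. R * real (x i) / real p)" for x :: "nat \<Rightarrow> nat"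
  have g_cube: "g x \<in> cube" if "\<forall>i<m. x i \<le> p" for x
    using that R p(1) by (auto simp: cube_def g_def field_simps intro!: mult_left_mono)
  \<comment> \<open>Label 0 marks a coordinate that \<open>F\<close> does not decrease, label 1 one
    that it does not increase. The extra clauses impose the boundary labels of Kuhn's lemma; they
    keep this meaning because \<open>F\<close> maps into the cube.\<close>
  define label where
    "label x i = (if x i = p \<or> x i \<noteq> 0 \<and> F (g x) i < g x i then 1 else 0 :: nat)" for x i
  have label_0: "g x i \<le> F (g x) i" if "\<forall>i<m. x i \<le> p" "i < m" "label x i = 0" for x i
    using that F[OF g_cube[OF that(1)]]
    by (auto simp: label_def g_def cube_def split: if_splits)
  have label_1: "F (g x) i \<le> g x i" if "\<forall>i<m. x i \<le> p" "i < m" "label x i \<noteq> 0" for x i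
    using that F[OF g_cube[OF that(1)]] p(1)
    by (auto simp: label_def g_def cube_def split: if_splits)
  obtain q where q: "\<forall>i<m. q i < p" and
    nbrs: "\<forall>i<m. \<exists>r s. (\<forall>j<m. q j \<le> r j \<and> r j \<le> q j + 1) \<and>
                       (\<forall>j<m. q j \<le> s j \<and> s j \<le> q j + 1) \<and> label r i \<noteq> label s i"
  proof (rule kuhn_lemma[of p m label])
    show "\<forall>x. (\<forall>i<m. x i \<le> p) \<longrightarrow> (\<forall>i<m. label x i = 0 \<or> label x i = 1)"
      "\<forall>x. (\<forall>i<m. x i \<le> p) \<longrightarrow> (\<forall>i<m. x i = 0 \<longrightarrow> label x i = 0)"
      "\<forall>x. (\<forall>i<m. x i \<le> p) \<longrightarrow> (\<forall>i<m. x i = p \<longrightarrow> label x i = 1)"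
      using p(1) by (auto simp: label_def)
  qed (rule p(1), rule that)
  have q_le: "\<forall>i<m. q i \<le> p"
    using q by auto
  have near: "(\<forall>j<m. r j \<le> p) \<and> (\<forall>j<m. g q j \<le> g r j \<and> g r j \<le> g q j + \<eta>)"
    if "\<forall>j<m. q j \<le> r j \<and> r j \<le> q j + 1" for r
  proof (intro conjI allI impI)
    fix j assume j: "j < m"
    show "r j \<le> p"
      using that q j by (metis Suc_eq_plus1 Suc_leI le_trans)
    show "g q j \<le> g r j"
      using that j R by (auto simp: g_def intro!: divide_right_mono mult_left_mono)
    have "real (r j) \<le> real (q j) + 1"
      using that j by (metis of_nat_1 of_nat_add of_nat_le_iff)
    then have "g r j \<le> R * (real (q j) + 1) / p"
      unfolding g_def using R by (intro divide_right_mono mult_left_mono) auto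
    also have "\<dots> = g q j + R / p"
      by (simp add: g_def ring_distribs add_divide_distrib)
    finally show "g r j \<le> g q j + \<eta>"
      using p(2) by simp
  qed
  have F_near: "\<bar>F (g q) i - F (g r) i\<bar> \<le> \<epsilon> / 2"
    if "\<forall>j<m. q j \<le> r j \<and> r j \<le> q j + 1" "i < m" for r i
  proof (rule F_close)
    show "g q \<in> cube" "g r \<in> cube"
      using g_cube near[OF that(1)] q_le by auto
    show "\<bar>g q j - g r j\<bar> \<le> \<delta>" if "j < m" for j
      using near[OF \<open>\<forall>j<m. q j \<le> r j \<and> r j \<le> q j + 1\<close>] that \<eta> by fastforce
  qed fact
  have "\<bar>F (g q) i - g q i\<bar> \<le> \<epsilon>" if i: "i < m" for i
  proof -
    obtain r s where r: "\<forall>j<m. q j \<le> r j \<and> r j \<le> q j + 1" "label r i = 0"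
      and s: "\<forall>j<m. q j \<le> s j \<and> s j \<le> q j + 1" "label s i \<noteq> 0"
    proof -
      obtain r s where rs: "\<forall>j<m. q j \<le> r j \<and> r j \<le> q j + 1"
        "\<forall>j<m. q j \<le> s j \<and> s j \<le> q j + 1" "label r i \<noteq> label s i"
        using nbrs i by blast
      have "label r i = 0 \<and> label s i \<noteq> 0 \<or> label s i = 0 \<and> label r i \<noteq> 0"
        using rs(3) by (auto simp: label_def split: if_splits)
      then show ?thesis
        using that rs(1,2) by blast
    qed
    have "g q i \<le> F (g r) i"
      using near[OF r(1)] label_0[OF _ i r(2)] i by fastforce
    moreover have "F (g s) i \<le> g q i + \<epsilon> / 2"
      using near[OF s(1)] label_1[OF _ i s(2)] i \<eta>(3) by fastforce
    ultimately show ?thesis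
      using F_near[OF r(1) i] F_near[OF s(1) i] \<epsilon> by linarith
  qed
  then show ?thesis
    using g_cube[OF q_le] by blast
qed

section \<open>Partitions of unity, convergence in mean, equicontinuous sequences\<close>

lemma compact_partition_of_unity:
  fixes C :: "'a::metric_space set"
  assumes "compact C" "C \<noteq> {}" "0 < e"
  obtains m :: nat and p :: "nat \<Rightarrow> 'a" and \<phi> :: "nat \<Rightarrow> 'a \<Rightarrow> real" where
    "\<And>i. continuous_on UNIV (\<phi> i)" "\<And>i x. 0 \<le> \<phi> i x" "\<And>x. (\<Sum>i<m. \<phi> i x) \<le> 1"
    "\<And>x. x \<in> C \<Longrightarrow> (\<Sum>i<m. \<phi> i x) = 1" "\<And>i x. \<phi> i x \<noteq> 0 \<Longrightarrow> dist (p i) x < e"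
proof -
  obtain P where P: "finite P" "C \<subseteq> (\<Union>z\<in>P. ball z e)"
    using compactE_image[OF assms(1), of C "\<lambda>z. ball z e"] assms(3)
    by (metis (no_types, lifting) UN_I centre_in_ball open_ball subsetI)
  obtain p and m :: nat where p: "P = p ` {i. i < m}"
    using finite_imp_nat_seg_image_inj_on[OF P(1)] by metis
  define \<psi> where "\<psi> i x = max 0 (e - dist (p i) x)" for i x
  \<comment> \<open>The term \<open>infdist x C\<close> keeps the denominator positive off
    \<open>C\<close> and vanishes on \<open>C\<close>, so the normalised weights sum to exactly 1 on
    \<open>C\<close> and to at most 1 elsewhere.\<close>
  define \<sigma> where "\<sigma> x = (\<Sum>i<m. \<psi> i x) + infdist x C" for x
  have \<psi>_nonneg: "0 \<le> \<psi> i x" for i x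
    by (simp add: \<psi>_def)
  then have sum_nonneg: "0 \<le> (\<Sum>i<m. \<psi> i x)" for x
    by (simp add: sum_nonneg)
  have \<sigma>_pos: "0 < \<sigma> x" for x
  proof (cases "x \<in> C")
    case True
    then obtain i where i: "i < m" "dist (p i) x < e"
      using P p by auto
    then have "0 < \<psi> i x" by (simp add: \<psi>_def)
    also have "\<psi> i x \<le> (\<Sum>i<m. \<psi> i x)"
      using i \<psi>_nonneg by (intro member_le_sum) auto
    finally show ?thesis
      using infdist_nonneg[of x C] by (simp add: \<sigma>_def)
  next
    case False
    then have "0 < infdist x C"
      using assms by (intro infdist_pos_not_in_closed) (auto intro: compact_imp_closed)
    then show ?thesis
      using sum_nonneg[of x] by (simp add: \<sigma>_def)
  qed
  define \<phi> where "\<phi> i x = \<psi> i x / \<sigma> x" for i x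
  have sum_\<phi>: "(\<Sum>i<m. \<phi> i x) = (\<Sum>i<m. \<psi> i x) / \<sigma> x" for x
    by (simp add: \<phi>_def sum_divide_distrib)
  show ?thesis
  proof (rule that)
    have "continuous_on UNIV (\<psi> i)" for i
      unfolding \<psi>_def by (intro continuous_intros)
    moreover from this have "continuous_on UNIV \<sigma>"
      unfolding \<sigma>_def by (intro continuous_intros)
    ultimately show "continuous_on UNIV (\<phi> i)" for i
      unfolding \<phi>_def using \<sigma>_pos
      by (intro continuous_on_divide) (auto simp: less_imp_neq[symmetric])
    show "0 \<le> \<phi> i x" for i x
      using \<psi>_nonneg \<sigma>_pos[of x] by (simp add: \<phi>_def)
    show "(\<Sum>i<m. \<phi> i x) \<le> 1" for x
      using \<sigma>_pos[of x] infdist_nonneg[of x C] by (simp add: sum_\<phi> \<sigma>_def)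
    show "(\<Sum>i<m. \<phi> i x) = 1" if "x \<in> C" for x
      using \<sigma>_pos[of x] that by (simp add: sum_\<phi> \<sigma>_def)
    show "dist (p i) x < e" if "\<phi> i x \<noteq> 0" for i x
      using that by (auto simp: \<phi>_def \<psi>_def max_def split: if_splits)
  qed
qed

text \<open>Scheffe's lemma for real-valued integrals, meant for a setting where the integrals are
  known to converge but no dominating function is at hand.\<close>

lemma Scheffe_integral:
  fixes f :: "'a \<Rightarrow> real"
  assumes F: "\<And>n. integrable M (F n)" "\<And>n x. 0 \<le> F n x"
    and f: "integrable M f" "\<And>x. 0 \<le> f x"
    and lim: "AE x in M. (\<lambda>n. F n x) \<longlonglongrightarrow> f x"
    and int: "(\<lambda>n. \<integral>x. F n x \<partial>M) \<longlonglongrightarrow> (\<integral>x. f x \<partial>M)"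
  shows "(\<lambda>n. \<integral>x. \<bar>F n x - f x\<bar> \<partial>M) \<longlonglongrightarrow> 0"
proof -
  have "(\<lambda>n. ennreal (\<integral>x. F n x \<partial>M)) \<longlonglongrightarrow> ennreal (\<integral>x. f x \<partial>M)"
    using int by (rule tendsto_ennrealI)
  then have "limsup (\<lambda>n. \<integral>\<^sup>+x. norm (F n x) \<partial>M) = (\<integral>\<^sup>+x. norm (f x) \<partial>M)"
    using F f by (simp add: nn_integral_eq_integral lim_imp_Limsup)
  then have "(\<lambda>n. \<integral>\<^sup>+x. norm (F n x - f x) \<partial>M) \<longlonglongrightarrow> 0"
    using F f lim by (intro Scheffe_lemma1) auto
  moreover have "(\<integral>\<^sup>+x. norm (F n x - f x) \<partial>M) = ennreal (\<integral>x. \<bar>F n x - f x\<bar> \<partial>M)" for n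
    using F f by (subst nn_integral_eq_integral) auto
  ultimately have "(\<lambda>n. ennreal (\<integral>x. \<bar>F n x - f x\<bar> \<partial>M)) \<longlonglongrightarrow> ennreal 0"
    by (simp only: ennreal_0)
  then show ?thesis
    by (rule tendsto_ennrealD) auto
qed

text \<open>A diagonal subsequence converges on a countable dense set; equicontinuity spreads the
  convergence to every point and makes the limit continuous.\<close>

lemma equicontinuous_convergent_subsequence:
  fixes g :: "nat \<Rightarrow> 'a::{second_countable_topology, metric_space} \<Rightarrow> real"
  assumes bound: "\<And>n x. norm (g n x) \<le> B"
    and equi: "\<And>x \<epsilon>. 0 < \<epsilon> \<Longrightarrow> \<exists>\<delta>>0. \<forall>x'. dist x' x < \<delta> \<longrightarrow> (\<forall>n. \<bar>g n x' - g n x\<bar> \<le> \<epsilon>)"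
  obtains k l where "strict_mono (k :: nat \<Rightarrow> nat)" "\<And>x. (\<lambda>n. g (k n) x) \<longlonglongrightarrow> l x"
    "continuous_on UNIV l"
proof -
  obtain D :: "'a set" where D: "countable D" "\<And>X. open X \<Longrightarrow> X \<noteq> {} \<Longrightarrow> \<exists>d\<in>D. d \<in> X"
    using countable_dense_exists by auto
  obtain k where k: "strict_mono (k :: nat \<Rightarrow> nat)"
    "\<And>x. x \<in> D \<Longrightarrow> \<exists>l. (\<lambda>n. g (k n) x) \<longlonglongrightarrow> l"
    using function_convergent_subsequence[OF D(1), of g B] bound by metis
  have "Cauchy (\<lambda>n. g (k n) x)" for x
  proof (rule metric_CauchyI)
    fix \<epsilon> :: real assume \<epsilon>: "0 < \<epsilon>"
    obtain \<delta> where \<delta>: "0 < \<delta>" "\<And>x' n. dist x' x < \<delta> \<Longrightarrow> \<bar>g n x' - g n x\<bar> \<le> \<epsilon> / 4"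
      using equi[of "\<epsilon> / 4" x] \<epsilon> by auto
    obtain d where d: "d \<in> D" "dist d x < \<delta>"
      using D(2)[of "ball x \<delta>"] \<delta>(1) by (auto simp: dist_commute)
    have "Cauchy (\<lambda>n. g (k n) d)"
      using k(2)[OF d(1)] by (meson convergentI convergent_Cauchy)
    then obtain M where M: "\<And>m n. M \<le> m \<Longrightarrow> M \<le> n \<Longrightarrow> dist (g (k m) d) (g (k n) d) < \<epsilon> / 4"
      using \<epsilon> by (metis metric_CauchyD zero_less_divide_iff zero_less_numeral)
    have "dist (g (k m) x) (g (k n) x) < \<epsilon>" if "M \<le> m" "M \<le> n" for m n
      using M[OF that] \<delta>(2)[OF d(2), of "k m"] \<delta>(2)[OF d(2), of "k n"] \<epsilon>
      unfolding dist_real_def by linarith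
    then show "\<exists>M. \<forall>m\<ge>M. \<forall>n\<ge>M. dist (g (k m) x) (g (k n) x) < \<epsilon>"
      by blast
  qed
  then have "\<forall>x. \<exists>l. (\<lambda>n. g (k n) x) \<longlonglongrightarrow> l"
    by (simp add: Cauchy_convergent_iff convergent_def)
  then obtain l where l: "\<And>x. (\<lambda>n. g (k n) x) \<longlonglongrightarrow> l x"
    by metis
  have "continuous_on UNIV l"
    unfolding continuous_on_iff
  proof (intro ballI allI impI)
    fix x and \<epsilon> :: real assume \<epsilon>: "0 < \<epsilon>"
    obtain \<delta> where \<delta>: "0 < \<delta>" "\<And>x' n. dist x' x < \<delta> \<Longrightarrow> \<bar>g n x' - g n x\<bar> \<le> \<epsilon> / 2"
      using equi[of "\<epsilon> / 2" x] \<epsilon> by auto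
    have "dist (l x') (l x) < \<epsilon>" if "dist x' x < \<delta>" for x'
    proof -
      have "(\<lambda>n. \<bar>g (k n) x' - g (k n) x\<bar>) \<longlonglongrightarrow> \<bar>l x' - l x\<bar>"
        by (intro tendsto_intros l)
      then have "\<bar>l x' - l x\<bar> \<le> \<epsilon> / 2"
        by (rule LIMSEQ_le_const2) (use \<delta>(2)[OF that] in auto)
      then show ?thesis
        using \<epsilon> by (simp add: dist_real_def)
    qed
    then show "\<exists>d>0. \<forall>x'\<in>UNIV. dist x' x < d \<longrightarrow> dist (l x') (l x) < \<epsilon>"
      using \<delta>(1) by auto
  qed
  with k(1) l show ?thesis
    by (rule that)
qed

section \<open>The operator on functions with values in \<open>{0..R}\<close>\<close>

text \<open>The growth condition on the nonlinearity is condensed into the invariance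
  \<open>H_B\<close>, which \<open>theorem7\<close> verifies. \<open>B\<close> is an order interval,
  so it is convex and contains every continuous pointwise limit of its elements.\<close>

locale hammerstein =
  fixes R :: real
    and K :: "'a::euclidean_space \<Rightarrow> 'a \<Rightarrow> real"
    and N :: "'a \<Rightarrow> real \<Rightarrow> real"
    and H :: "('a \<Rightarrow>\<^sub>C real) \<Rightarrow> ('a \<Rightarrow>\<^sub>C real)"
    and B :: "('a \<Rightarrow>\<^sub>C real) set"
  defines "B \<equiv> {f \<in> bcontfun_nonneg. \<forall>x. apply_bcontfun f x \<le> R}"
  assumes R_nonneg: "0 \<le> R"
    and kernel: "caratheodory_kernel K"
    and N_nonneg: "\<And>y z. 0 \<le> z \<Longrightarrow> 0 \<le> N y z"
    and N_cont: "\<And>z0 \<epsilon>. 0 \<le> z0 \<Longrightarrow> 0 < \<epsilon> \<Longrightarrow>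
           \<exists>\<delta>>0. AE y in lebesgue. \<forall>z\<ge>0. \<bar>z - z0\<bar> \<le> \<delta> \<longrightarrow> \<bar>N y z - N y z0\<bar> \<le> \<epsilon>"
    and H_B: "\<And>f. f \<in> B \<Longrightarrow> H f \<in> B"
    and H_integrable: "\<And>f x. f \<in> B \<Longrightarrow> integrable lebesgue (\<lambda>y. K x y * N y (f y))"
    and H_eq: "\<And>f x. f \<in> B \<Longrightarrow> H f x = (LINT y|lebesgue. K x y * N y (f y))"
begin

lemma B_D: "f \<in> B \<Longrightarrow> 0 \<le> apply_bcontfun f x \<and> apply_bcontfun f x \<le> R"
  by (simp add: B_def bcontfun_nonneg_def)

lemma B_I:
  assumes "continuous_on UNIV f" "\<And>x. 0 \<le> f x" "\<And>x. f x \<le> R"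
  shows "Bcontfun f \<in> B" "apply_bcontfun (Bcontfun f) = f"
proof -
  have "f \<in> bcontfun"
    using assms by (intro bcontfun_normI[where b = R]) auto
  then show "apply_bcontfun (Bcontfun f) = f"
    by (simp add: Bcontfun_inverse)
  then show "Bcontfun f \<in> B"
    using assms by (simp add: B_def bcontfun_nonneg_def)
qed

section \<open>Integrability and continuity of the kernel\<close>

lemma K_nonneg: "0 \<le> K x y"
  and K_measurable: "K x \<in> borel_measurable lebesgue"
  and K_continuous: "AE y in lebesgue. continuous_on UNIV (\<lambda>x. K x y)"
  using kernel by (auto simp: caratheodory_kernel_def)

lemma K_integral_bounded:
  obtains L where "0 \<le> L" "\<And>x. integrable lebesgue (K x)" "\<And>x. (LINT y|lebesgue. K x y) \<le> L"
proof -
  define L where "L = (SUP x. \<integral>\<^sup>+y. ennreal (K x y) \<partial>lebesgue)"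
  have L: "L < \<infinity>"
    using kernel K_nonneg by (simp add: L_def caratheodory_kernel_def)
  have le: "(\<integral>\<^sup>+y. ennreal (K x y) \<partial>lebesgue) \<le> L" for x
    unfolding L_def by (rule SUP_upper) simp
  have int: "integrable lebesgue (K x)" for x
  proof (rule integrableI_bounded)
    show "(\<integral>\<^sup>+y. ennreal (norm (K x y)) \<partial>lebesgue) < \<infinity>"
      using le[of x] L K_nonneg by (simp add: le_less_trans)
  qed (rule K_measurable)
  show ?thesis
  proof (rule that)
    show "(LINT y|lebesgue. K x y) \<le> enn2real L" for x
    proof -
      have "ennreal (LINT y|lebesgue. K x y) \<le> L"
        using le[of x] K_nonneg by (simp add: nn_integral_eq_integral int)
      then show ?thesis
        using L K_nonneg enn2real_mono[of "ennreal (LINT y|lebesgue. K x y)" L] by simp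
    qed
  qed (auto simp: int)
qed

lemma K_integrable: "integrable lebesgue (K x)"
  using K_integral_bounded by metis

text \<open>The null set in \<open>K_continuous\<close> does not depend on \<open>x\<close>, so it
  serves the whole sequence.\<close>

lemma K_tendsto:
  assumes "x \<longlonglongrightarrow> x0"
  shows "AE y in lebesgue. (\<lambda>n. K (x n) y) \<longlonglongrightarrow> K x0 y"
  using K_continuous
  by eventually_elim (rule continuous_on_tendsto_compose[where s = UNIV], auto simp: assms)

lemma K_integral_continuous:
  assumes "x \<longlonglongrightarrow> x0"
  shows "(\<lambda>n. LINT y|lebesgue. K (x n) y) \<longlonglongrightarrow> (LINT y|lebesgue. K x0 y)"
proof -
  obtain U D where U: "open U" "x0 \<in> U" and D: "integrable lebesgue D"
    "\<And>x. x \<in> U \<Longrightarrow> AE y in lebesgue. \<bar>K x y\<bar> \<le> D y"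
    using kernel unfolding caratheodory_kernel_def by metis
  obtain n0 where n0: "\<And>n. n0 \<le> n \<Longrightarrow> x n \<in> U"
    using topological_tendstoD[OF assms U] by (auto simp: eventually_sequentially)
  \<comment> \<open>The majorant \<open>D\<close> from (Car3) is valid only near \<open>x0\<close>,
    so the first \<open>n0\<close> terms are dropped.\<close>
  have "(\<lambda>n. LINT y|lebesgue. K (x (n + n0)) y) \<longlonglongrightarrow> (LINT y|lebesgue. K x0 y)"
  proof (rule integral_dominated_convergence)
    show "AE y in lebesgue. (\<lambda>n. K (x (n + n0)) y) \<longlonglongrightarrow> K x0 y"
      using K_tendsto[OF assms] by eventually_elim (rule LIMSEQ_ignore_initial_segment)
    show "AE y in lebesgue. norm (K (x (n + n0)) y) \<le> D y" for n
      using D(2)[OF n0[of "n + n0"]] by simp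
  qed (auto simp: K_measurable D)
  then show ?thesis
    by (rule LIMSEQ_offset)
qed

section \<open>Equicontinuity and oscillation of the nonlinearity on \<open>{0..R}\<close>\<close>

text \<open>Each centre in (N2) has its own radius and null set. Compactness of
  \<open>{0..R}\<close> leaves finitely many centres, hence one null set, and a Lebesgue number of
  the cover gives a common radius.\<close>

lemma N_uniform:
  assumes "0 < \<epsilon>"
  obtains \<delta> where "0 < \<delta>" "AE y in lebesgue. \<forall>z\<in>{0..R}. \<forall>w\<in>{0..R}.
      \<bar>z - w\<bar> \<le> \<delta> \<longrightarrow> \<bar>N y z - N y w\<bar> \<le> \<epsilon>"
proof -
  let ?P = "\<lambda>z0 \<delta>. 0 < \<delta> \<and>
    (AE y in lebesgue. \<forall>z\<ge>0. \<bar>z - z0\<bar> \<le> \<delta> \<longrightarrow> \<bar>N y z - N y z0\<bar> \<le> \<epsilon> / 2)"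
  have "\<forall>z0\<in>{0..R}. \<exists>\<delta>. ?P z0 \<delta>"
    using N_cont[of _ "\<epsilon> / 2"] assms by simp
  then obtain d where "\<forall>z0\<in>{0..R}. ?P z0 (d z0)"
    by (rule bchoice[THEN exE])
  then have d: "\<And>z0. z0 \<in> {0..R} \<Longrightarrow> 0 < d z0"
    "\<And>z0. z0 \<in> {0..R} \<Longrightarrow>
      AE y in lebesgue. \<forall>z\<ge>0. \<bar>z - z0\<bar> \<le> d z0 \<longrightarrow> \<bar>N y z - N y z0\<bar> \<le> \<epsilon> / 2"
    by blast+
  obtain P where P: "P \<subseteq> {0..R}" "finite P" "{0..R} \<subseteq> (\<Union>z\<in>P. ball z (d z))"
  proof (rule compactE_image[of "{0..R}" "{0..R}" "\<lambda>z. ball z (d z)"])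
    show "{0..R} \<subseteq> (\<Union>z\<in>{0..R}. ball z (d z))"
      using d(1) by (meson UN_I centre_in_ball subsetI)
  qed auto
  obtain \<delta> where \<delta>: "0 < \<delta>"
    "\<And>z. z \<in> {0..R} \<Longrightarrow> \<exists>G\<in>(\<lambda>z. ball z (d z)) ` P. ball z \<delta> \<subseteq> G"
    using Heine_Borel_lemma[of "{0..R}" "(\<lambda>z. ball z (d z)) ` P"] P(3) by auto
  have "AE y in lebesgue. \<forall>z0\<in>P. \<forall>z\<ge>0. \<bar>z - z0\<bar> \<le> d z0 \<longrightarrow> \<bar>N y z - N y z0\<bar> \<le> \<epsilon> / 2"
    using P d(2) by (intro AE_finite_allI) auto
  \<comment> \<open>Half the Lebesgue number puts \<open>z\<close> and \<open>w\<close> strictly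
    inside \<open>ball z \<delta>\<close>, hence both near the same centre.\<close>
  then have "AE y in lebesgue. \<forall>z\<in>{0..R}. \<forall>w\<in>{0..R}. \<bar>z - w\<bar> \<le> \<delta> / 2 \<longrightarrow> \<bar>N y z - N y w\<bar> \<le> \<epsilon>"
  proof eventually_elim
    case (elim y)
    show ?case
    proof (intro ballI impI)
      fix z w assume zw: "z \<in> {0..R}" "w \<in> {0..R}" "\<bar>z - w\<bar> \<le> \<delta> / 2"
      obtain z0 where z0: "z0 \<in> P" "ball z \<delta> \<subseteq> ball z0 (d z0)"
        using \<delta>(2)[OF zw(1)] by auto
      have "z \<in> ball z \<delta>" "w \<in> ball z \<delta>"
        using \<delta>(1) zw(3) by (auto simp: dist_real_def)
      then have "z \<in> ball z0 (d z0)" "w \<in> ball z0 (d z0)"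
        using z0(2) by blast+
      then have "\<bar>z - z0\<bar> \<le> d z0" "\<bar>w - z0\<bar> \<le> d z0"
        by (auto simp: dist_real_def)
      then have "\<bar>N y z - N y z0\<bar> \<le> \<epsilon> / 2" "\<bar>N y w - N y z0\<bar> \<le> \<epsilon> / 2"
        using elim z0(1) zw by auto
      then show "\<bar>N y z - N y w\<bar> \<le> \<epsilon>"
        by linarith
    qed
  qed
  then show ?thesis
    using that[of "\<delta> / 2"] \<delta>(1) by simp
qed

text \<open>Descending from \<open>z\<close> to 0 in steps of length at most \<open>\<delta>\<close>
  changes \<open>N y\<close> by at most 1 per step, and the number of steps does not depend on
  \<open>y\<close>. This makes \<open>K x y * (N y 0 + M)\<close> a common majorant of the
  integrands for all functions in \<open>B\<close>.\<close>

lemma N_oscillation_bounded: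
  obtains M where "0 \<le> M" "AE y in lebesgue. \<forall>z\<in>{0..R}. N y z \<le> N y 0 + M"
proof -
  obtain \<delta> where \<delta>: "0 < \<delta>" and ae: "AE y in lebesgue. \<forall>z\<in>{0..R}. \<forall>w\<in>{0..R}.
      \<bar>z - w\<bar> \<le> \<delta> \<longrightarrow> \<bar>N y z - N y w\<bar> \<le> 1"
    using N_uniform[of 1] by auto
  obtain k :: nat where k: "R / \<delta> \<le> k"
    using real_arch_simple by blast
  from ae have "AE y in lebesgue. \<forall>z\<in>{0..R}. N y z \<le> N y 0 + k"
  proof eventually_elim
    case (elim y)
    have "N y z \<le> N y 0 + j" if "z \<in> {0..R}" "z \<le> j * \<delta>" for z and j :: nat
      using that
    proof (induction j arbitrary: z)
      case (Suc j)
      \<comment> \<open>Truncation at 0 keeps a last, shorter step inside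
        \<open>{0..R}\<close>.\<close>
      define w where "w = max 0 (z - \<delta>)"
      have w: "w \<in> {0..R}" "w \<le> j * \<delta>" "\<bar>z - w\<bar> \<le> \<delta>"
        using Suc.prems \<delta> by (auto simp: w_def algebra_simps)
      then have "\<bar>N y z - N y w\<bar> \<le> 1"
        using elim Suc.prems by blast
      then show ?case
        using Suc.IH[OF w(1,2)] by simp
    qed simp
    from this[of _ k] show ?case
      using k \<delta> by (auto simp: field_simps intro: order_trans)
  qed
  then show ?thesis
    using that[of "real k"] by simp
qed

section \<open>Continuity of the operator and equicontinuity of its image\<close>

text \<open>The integrands differ by at most \<open>\<eta> * K x y\<close>, and the integrals of
  \<open>K x\<close> are bounded uniformly in \<open>x\<close>. This provides the modulus required
  by \<open>approximate_brouwer_cube\<close>.\<close>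

lemma H_uniformly_continuous:
  assumes "0 < \<epsilon>"
  obtains \<delta> where "0 < \<delta>"
    "\<And>f g x. f \<in> B \<Longrightarrow> g \<in> B \<Longrightarrow> (\<And>y. \<bar>f y - g y\<bar> \<le> \<delta>) \<Longrightarrow> \<bar>H f x - H g x\<bar> \<le> \<epsilon>"
proof -
  obtain L where L: "0 \<le> L" "\<And>x. integrable lebesgue (K x)"
    "\<And>x. (LINT y|lebesgue. K x y) \<le> L"
    using K_integral_bounded by blast
  \<comment> \<open>The denominator \<open>L + 1\<close> covers the case
    \<open>L = 0\<close>.\<close>
  define \<eta> where "\<eta> = \<epsilon> / (L + 1)"
  have \<eta>: "0 < \<eta>" "\<eta> * L \<le> \<epsilon>"
    using assms L(1) by (auto simp: \<eta>_def field_simps)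
  obtain \<delta> where \<delta>: "0 < \<delta>" and ae: "AE y in lebesgue. \<forall>z\<in>{0..R}. \<forall>w\<in>{0..R}.
      \<bar>z - w\<bar> \<le> \<delta> \<longrightarrow> \<bar>N y z - N y w\<bar> \<le> \<eta>"
    using N_uniform[OF \<eta>(1)] by auto
  have "\<bar>H f x - H g x\<bar> \<le> \<epsilon>" if f: "f \<in> B" and g: "g \<in> B" and fg: "\<And>y. \<bar>f y - g y\<bar> \<le> \<delta>" for f g x
  proof -
    have "\<bar>H f x - H g x\<bar> = \<bar>LINT y|lebesgue. K x y * N y (f y) - K x y * N y (g y)\<bar>"
      using f g by (simp add: H_eq H_integrable)
    also have "\<dots> \<le> (LINT y|lebesgue. \<bar>K x y * N y (f y) - K x y * N y (g y)\<bar>)"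
      by (rule integral_abs_bound)
    also have "\<dots> \<le> (LINT y|lebesgue. \<eta> * K x y)"
    proof (rule integral_mono_AE)
      show "AE y in lebesgue. \<bar>K x y * N y (f y) - K x y * N y (g y)\<bar> \<le> \<eta> * K x y"
        using ae
      proof eventually_elim
        case (elim y)
        then have "\<bar>N y (f y) - N y (g y)\<bar> \<le> \<eta>"
          using B_D[OF f] B_D[OF g] fg by auto
        then have "K x y * \<bar>N y (f y) - N y (g y)\<bar> \<le> K x y * \<eta>"
          using K_nonneg by (rule mult_left_mono)
        then show ?case
          using K_nonneg[of x y] by (simp add: abs_mult mult.commute flip: right_diff_distrib)
      qed
    qed (use f g in \<open>auto simp: H_integrable L\<close>)
    also have "\<dots> \<le> \<eta> * L"
      using L(3) \<eta>(1) by simp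
    also note \<eta>(2)
    finally show ?thesis .
  qed
  with \<delta> show ?thesis
    by (rule that)
qed

lemma zero_B: "0 \<in> B"
  using R_nonneg by (simp add: B_def bcontfun_nonneg_def)

text \<open>The part with \<open>N y 0\<close> is the integrand of \<open>H 0\<close>; the rest is a
  multiple of \<open>K x\<close>.\<close>

lemma weighted_K_integrable: "integrable lebesgue (\<lambda>y. K x y * (N y 0 + M))"
proof -
  have "integrable lebesgue (\<lambda>y. K x y * N y 0 + K x y * M)"
    using H_integrable[OF zero_B, of x] K_integrable[of x] by simp
  then show ?thesis
    by (simp add: ring_distribs)
qed

text \<open>\<^term>\<open>N y 0\<close> need not be integrable or bounded in \<^term>\<open>y\<close>. The continuity of
  \<^term>\<open>H 0\<close> nevertheless yields convergence of the integrals, which Scheffe's lemma upgrades to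
  convergence in mean of the weighted kernels.\<close>

lemma weighted_K_continuous:
  assumes "x \<longlonglongrightarrow> x0" "0 \<le> M"
  shows "(\<lambda>n. LINT y|lebesgue. \<bar>K (x n) y * (N y 0 + M) - K x0 y * (N y 0 + M)\<bar>) \<longlonglongrightarrow> 0"
proof (rule Scheffe_integral)
  show "AE y in lebesgue. (\<lambda>n. K (x n) y * (N y 0 + M)) \<longlonglongrightarrow> K x0 y * (N y 0 + M)"
    using K_tendsto[OF assms(1)] by eventually_elim (intro tendsto_intros)
  have eq: "(LINT y|lebesgue. K x y * (N y 0 + M)) = H 0 x + (LINT y|lebesgue. K x y) * M" for x
    using H_integrable[OF zero_B, of x] H_eq[OF zero_B, of x] K_integrable[of x]
    by (simp add: ring_distribs)
  have "(\<lambda>n. H 0 (x n)) \<longlonglongrightarrow> H 0 x0"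
    by (rule continuous_on_tendsto_compose[where s = UNIV]) (auto simp: assms)
  then show "(\<lambda>n. LINT y|lebesgue. K (x n) y * (N y 0 + M)) \<longlonglongrightarrow>
      (LINT y|lebesgue. K x0 y * (N y 0 + M))"
    unfolding eq by (intro tendsto_intros K_integral_continuous assms)
qed (use assms in \<open>auto simp: weighted_K_integrable K_nonneg N_nonneg\<close>)

text \<open>The bound \<open>J x\<close> does not involve \<open>f\<close>, so its continuity at
  \<open>x0\<close> yields one \<open>\<delta>\<close> for the whole of \<open>B\<close>.\<close>

lemma H_equicontinuous:
  assumes "0 < \<epsilon>"
  shows "\<exists>\<delta>>0. \<forall>x. dist x x0 < \<delta> \<longrightarrow> (\<forall>f\<in>B. \<bar>H f x - H f x0\<bar> \<le> \<epsilon>)"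
proof -
  obtain M where M: "0 \<le> M" "AE y in lebesgue. \<forall>z\<in>{0..R}. N y z \<le> N y 0 + M"
    by (rule N_oscillation_bounded)
  define J where "J x = (LINT y|lebesgue. \<bar>K x y * (N y 0 + M) - K x0 y * (N y 0 + M)\<bar>)" for x
  have H_le_J: "\<bar>H f x - H f x0\<bar> \<le> J x" if f: "f \<in> B" for f x
  proof -
    have "\<bar>H f x - H f x0\<bar> = \<bar>LINT y|lebesgue. K x y * N y (f y) - K x0 y * N y (f y)\<bar>"
      using f by (simp add: H_eq H_integrable)
    also have "\<dots> \<le> (LINT y|lebesgue. \<bar>K x y * N y (f y) - K x0 y * N y (f y)\<bar>)"
      by (rule integral_abs_bound)
    also have "\<dots> \<le> J x"
      unfolding J_def
    proof (rule integral_mono_AE)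
      show "AE y in lebesgue. \<bar>K x y * N y (f y) - K x0 y * N y (f y)\<bar>
          \<le> \<bar>K x y * (N y 0 + M) - K x0 y * (N y 0 + M)\<bar>"
        using M(2)
      proof eventually_elim
        case (elim y)
        then have "0 \<le> N y (f y)" "N y (f y) \<le> N y 0 + M"
          using B_D[OF f] N_nonneg by auto
        then have "\<bar>K x y - K x0 y\<bar> * \<bar>N y (f y)\<bar> \<le> \<bar>K x y - K x0 y\<bar> * \<bar>N y 0 + M\<bar>"
          by (intro mult_left_mono) auto
        then show ?case
          by (simp only: left_diff_distrib[symmetric] abs_mult)
      qed
    qed (use f in \<open>auto simp: H_integrable weighted_K_integrable\<close>)
    finally show ?thesis .
  qed
  have "J x0 = 0"
    by (simp add: J_def)
  then have "isCont J x0"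
    using weighted_K_continuous[OF _ M(1), of _ x0]
    by (simp add: continuous_at_sequentially o_def J_def)
  then obtain \<delta> where \<delta>: "0 < \<delta>" "\<And>x. dist x x0 < \<delta> \<Longrightarrow> dist (J x) (J x0) < \<epsilon>"
    using assms unfolding continuous_at_eps_delta by blast
  have "\<bar>H f x - H f x0\<bar> \<le> \<epsilon>" if "dist x x0 < \<delta>" "f \<in> B" for f x
    using \<delta>(2)[OF that(1)] H_le_J[OF that(2), of x] \<open>J x0 = 0\<close> by (simp add: dist_real_def)
  with \<delta>(1) show ?thesis
    by blast
qed

text \<open>The null set in \<open>N_uniform\<close> varies with the tolerance. Countably many
  tolerances tending to 0 produce a single null set, off which \<open>N y\<close> is
  continuous.\<close>

lemma N_continuous: "AE y in lebesgue. continuous_on {0..R} (N y)"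
proof -
  let ?P = "\<lambda>k \<delta>. 0 < \<delta> \<and> (AE y in lebesgue. \<forall>z\<in>{0..R}. \<forall>w\<in>{0..R}.
      \<bar>z - w\<bar> \<le> \<delta> \<longrightarrow> \<bar>N y z - N y w\<bar> \<le> inverse (real (Suc k)))"
  have "\<exists>\<delta>. ?P k \<delta>" for k
  proof -
    have "0 < inverse (real (Suc k))"
      by simp
    then show ?thesis
      by (rule N_uniform) blast
  qed
  then obtain \<delta> where "\<forall>k. ?P k (\<delta> k)"
    by (rule choice[OF allI, THEN exE])
  then have \<delta>: "\<And>k. 0 < \<delta> k" "\<And>k. AE y in lebesgue. \<forall>z\<in>{0..R}. \<forall>w\<in>{0..R}.
      \<bar>z - w\<bar> \<le> \<delta> k \<longrightarrow> \<bar>N y z - N y w\<bar> \<le> inverse (real (Suc k))"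
    by blast+
  have "AE y in lebesgue. \<forall>k. \<forall>z\<in>{0..R}. \<forall>w\<in>{0..R}.
      \<bar>z - w\<bar> \<le> \<delta> k \<longrightarrow> \<bar>N y z - N y w\<bar> \<le> inverse (real (Suc k))"
    unfolding AE_all_countable by (intro allI \<delta>(2))
  then show ?thesis
  proof eventually_elim
    case (elim y)
    show ?case
      unfolding continuous_on_iff
    proof (intro ballI allI impI)
      fix z \<epsilon> :: real assume z: "z \<in> {0..R}" and "0 < \<epsilon>"
      then obtain k where k: "inverse (real (Suc k)) < \<epsilon>"
        using reals_Archimedean by blast
      have "dist (N y w) (N y z) < \<epsilon>" if "w \<in> {0..R}" "dist w z < \<delta> k" for w
      proof -
        have "\<bar>N y w - N y z\<bar> \<le> inverse (real (Suc k))"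
          using elim z that by (auto simp: dist_real_def)
        then show ?thesis
          using k by (simp add: dist_real_def)
      qed
      then show "\<exists>d>0. \<forall>w\<in>{0..R}. dist w z < d \<longrightarrow> dist (N y w) (N y z) < \<epsilon>"
        using \<delta>(1) by blast
    qed
  qed
qed

text \<open>Dominated convergence with the common majorant supplied by
  \<open>N_oscillation_bounded\<close>.\<close>

lemma H_pointwise_continuous:
  assumes f: "\<And>n. f n \<in> B" and g: "g \<in> B" and lim: "\<And>y. (\<lambda>n. f n y) \<longlonglongrightarrow> g y"
  shows "(\<lambda>n. H (f n) x) \<longlonglongrightarrow> H g x"
proof -
  obtain M where M: "0 \<le> M" "AE y in lebesgue. \<forall>z\<in>{0..R}. N y z \<le> N y 0 + M"
    by (rule N_oscillation_bounded)
  have "(\<lambda>n. LINT y|lebesgue. K x y * N y (f n y)) \<longlonglongrightarrow> (LINT y|lebesgue. K x y * N y (g y))"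
  proof (rule integral_dominated_convergence)
    show "integrable lebesgue (\<lambda>y. K x y * (N y 0 + M))"
      by (rule weighted_K_integrable)
    show "AE y in lebesgue. (\<lambda>n. K x y * N y (f n y)) \<longlonglongrightarrow> K x y * N y (g y)"
      using N_continuous
    proof eventually_elim
      case (elim y)
      have "(\<lambda>n. N y (f n y)) \<longlonglongrightarrow> N y (g y)"
        by (rule continuous_on_tendsto_compose[OF elim lim]) (use B_D[OF f] B_D[OF g] in auto)
      then show ?case
        by (intro tendsto_intros)
    qed
    show "AE y in lebesgue. norm (K x y * N y (f n y)) \<le> K x y * (N y 0 + M)" for n
      using M(2)
    proof eventually_elim
      case (elim y)
      have "\<bar>N y (f n y)\<bar> \<le> N y 0 + M"
        using elim B_D[OF f] N_nonneg by auto
      then show ?case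
        using K_nonneg[of x y] by (simp add: abs_mult mult_left_mono)
    qed
  qed (use H_integrable f g in \<open>auto intro: borel_measurable_integrable\<close>)
  then show ?thesis
    using f g by (simp add: H_eq)
qed

section \<open>Schauder approximation and passage to the limit\<close>

text \<open>The oscillation \<open>\<eta>\<close> of \<open>H f\<close> stays a parameter because
  \<open>f\<close> is found only in the proof; \<open>H_equicontinuous\<close> later bounds it for
  all of \<open>B\<close> at once.\<close>

lemma approximate_fixed_point:
  assumes C: "compact C" "C \<noteq> {}" and e: "0 < e"
  obtains f where "f \<in> B"
    "\<And>x \<eta>. x \<in> C \<Longrightarrow> (\<And>x'. dist x' x < e \<Longrightarrow> \<bar>H f x' - H f x\<bar> \<le> \<eta>) \<Longrightarrow> \<bar>f x - H f x\<bar> \<le> e + \<eta>"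
proof -
  obtain m :: nat and p and \<phi> :: "nat \<Rightarrow> 'a \<Rightarrow> real" where \<phi>:
    "\<And>i. continuous_on UNIV (\<phi> i)" "\<And>i x. 0 \<le> \<phi> i x" "\<And>x. (\<Sum>i<m. \<phi> i x) \<le> 1"
    "\<And>x. x \<in> C \<Longrightarrow> (\<Sum>i<m. \<phi> i x) = 1" "\<And>i x. \<phi> i x \<noteq> 0 \<Longrightarrow> dist (p i) x < e"
    using compact_partition_of_unity[OF C e] by metis
  define cube where "cube = {a. \<forall>i<m. 0 \<le> a i \<and> a i \<le> R}"
  \<comment> \<open>\<open>u a\<close> blends the values \<open>a i\<close> attached to the nodes
    \<open>p i\<close>. The finite-dimensional map to be treated sends \<open>a\<close> to the
    values of \<open>H (u a)\<close> at the nodes.\<close>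
  define u where "u a = Bcontfun (\<lambda>x. \<Sum>i<m. a i * \<phi> i x)" for a
  \<comment> \<open>The condition \<open>0 \<le> s\<close> matters off \<open>C\<close>, where the
    weights may sum to less than 1.\<close>
  have sum_le: "(\<Sum>i<m. b i * \<phi> i x) \<le> s" if "\<And>i. i < m \<Longrightarrow> b i \<le> s" "0 \<le> s" for b s x
  proof -
    have "(\<Sum>i<m. b i * \<phi> i x) \<le> (\<Sum>i<m. s * \<phi> i x)"
      using that \<phi>(2) by (intro sum_mono mult_right_mono) auto
    also have "\<dots> \<le> s"
      using mult_left_mono[OF \<phi>(3)[of x] that(2)] by (simp add: sum_distrib_left)
    finally show ?thesis .
  qed
  have u: "u a \<in> B" "apply_bcontfun (u a) = (\<lambda>x. \<Sum>i<m. a i * \<phi> i x)" if "a \<in> cube" for a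
  proof -
    have "continuous_on UNIV (\<lambda>x. \<Sum>i<m. a i * \<phi> i x)"
      by (intro continuous_intros \<phi>(1))
    moreover have "0 \<le> (\<Sum>i<m. a i * \<phi> i x)" for x
      using that \<phi>(2) by (intro sum_nonneg) (auto simp: cube_def)
    moreover have "(\<Sum>i<m. a i * \<phi> i x) \<le> R" for x
      using that R_nonneg by (intro sum_le) (auto simp: cube_def)
    ultimately show "u a \<in> B" "apply_bcontfun (u a) = (\<lambda>x. \<Sum>i<m. a i * \<phi> i x)"
      unfolding u_def by (rule B_I)+
  qed
  have u_close: "\<bar>u a x - u b x\<bar> \<le> \<delta>"
    if "a \<in> cube" "b \<in> cube" "\<And>i. i < m \<Longrightarrow> \<bar>a i - b i\<bar> \<le> \<delta>" "0 \<le> \<delta>" for a b \<delta> x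
  proof -
    have "\<bar>u a x - u b x\<bar> = \<bar>\<Sum>i<m. (a i - b i) * \<phi> i x\<bar>"
      using that by (simp add: u left_diff_distrib sum_subtractf)
    also have "\<dots> \<le> (\<Sum>i<m. \<bar>a i - b i\<bar> * \<phi> i x)"
      using sum_abs[of "\<lambda>i. (a i - b i) * \<phi> i x" "{..<m}"] \<phi>(2) by (simp add: abs_mult)
    also have "\<dots> \<le> \<delta>"
      using that by (intro sum_le)
    finally show ?thesis .
  qed
  have "\<exists>a\<in>cube. \<forall>i<m. \<bar>H (u a) (p i) - a i\<bar> \<le> e"
  proof (rule approximate_brouwer_cube[where m = m and F = "\<lambda>a i. H (u a) (p i)",
        OF R_nonneg, folded cube_def])
    show "(\<lambda>i. H (u a) (p i)) \<in> cube" if "a \<in> cube" for a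
      using B_D[OF H_B[OF u(1)[OF that]]] by (simp add: cube_def)
    fix \<epsilon> :: real assume "0 < \<epsilon>"
    then obtain \<delta> where \<delta>: "0 < \<delta>"
      "\<And>f g x. f \<in> B \<Longrightarrow> g \<in> B \<Longrightarrow> (\<And>y. \<bar>f y - g y\<bar> \<le> \<delta>) \<Longrightarrow> \<bar>H f x - H g x\<bar> \<le> \<epsilon>"
      using H_uniformly_continuous by blast
    then show "\<exists>\<delta>>0. \<forall>a\<in>cube. \<forall>b\<in>cube. (\<forall>i<m. \<bar>a i - b i\<bar> \<le> \<delta>) \<longrightarrow>
        (\<forall>i<m. \<bar>H (u a) (p i) - H (u b) (p i)\<bar> \<le> \<epsilon>)"
      using u(1) u_close by (intro exI[of _ \<delta>]) (auto intro!: \<delta>(2))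
  qed (rule e)
  then obtain a where a: "a \<in> cube" "\<And>i. i < m \<Longrightarrow> \<bar>H (u a) (p i) - a i\<bar> \<le> e"
    by blast
  \<comment> \<open>On \<open>C\<close> the weights sum to 1, so the difference is an average of
    \<open>a i - H (u a) x\<close>. Only nodes within \<open>e\<close> of \<open>x\<close>
    contribute: there \<open>a i\<close> is within \<open>e\<close> of \<open>H (u a) (p i)\<close>,
    which is within \<open>\<eta>\<close> of \<open>H (u a) x\<close>.\<close>
  have "\<bar>u a x - H (u a) x\<bar> \<le> e + \<eta>"
    if x: "x \<in> C" and \<eta>: "\<And>x'. dist x' x < e \<Longrightarrow> \<bar>H (u a) x' - H (u a) x\<bar> \<le> \<eta>" for x \<eta>
  proof -
    have "u a x - H (u a) x = (\<Sum>i<m. (a i - H (u a) x) * \<phi> i x)"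
      using \<phi>(4)[OF x] a(1) by (simp add: u left_diff_distrib sum_subtractf flip: sum_distrib_left)
    also have "\<bar>\<dots>\<bar> \<le> (\<Sum>i<m. \<bar>a i - H (u a) x\<bar> * \<phi> i x)"
      using sum_abs[of "\<lambda>i. (a i - H (u a) x) * \<phi> i x" "{..<m}"] \<phi>(2) by (simp add: abs_mult)
    also have "\<dots> \<le> (\<Sum>i<m. (e + \<eta>) * \<phi> i x)"
    proof (rule sum_mono)
      fix i assume i: "i \<in> {..<m}"
      show "\<bar>a i - H (u a) x\<bar> * \<phi> i x \<le> (e + \<eta>) * \<phi> i x"
      proof (cases "\<phi> i x = 0")
        case False
        then have "\<bar>a i - H (u a) x\<bar> \<le> e + \<eta>"
          using \<eta>[OF \<phi>(5)] a(2)[of i] i by fastforce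
        then show ?thesis
          using \<phi>(2) by (rule mult_right_mono)
      qed simp
    qed
    also have "\<dots> = e + \<eta>"
      using \<phi>(4)[OF x] by (simp flip: sum_distrib_left)
    finally show ?thesis .
  qed
  with u(1)[OF a(1)] show ?thesis
    by (rule that)
qed

lemma fixed_point: "\<exists>f\<in>B. H f = f"
proof -
  \<comment> \<open>The balls exhaust the space while the tolerance shrinks, so each point is
    eventually covered with arbitrarily small error.\<close>
  have "\<exists>f. f \<in> B \<and> (\<forall>x \<eta>. norm x \<le> real n \<longrightarrow>
      (\<forall>x'. dist x' x < inverse (real (Suc n)) \<longrightarrow> \<bar>H f x' - H f x\<bar> \<le> \<eta>) \<longrightarrow>
      \<bar>f x - H f x\<bar> \<le> inverse (real (Suc n)) + \<eta>)" for n
  proof -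
    have "cball (0::'a) (real n) \<noteq> {}" "0 < inverse (real (Suc n))"
      by auto
    from approximate_fixed_point[OF compact_cball this] show ?thesis
      by (metis mem_cball_0)
  qed
  then obtain f where "\<forall>n. f n \<in> B \<and> (\<forall>x \<eta>. norm x \<le> real n \<longrightarrow>
      (\<forall>x'. dist x' x < inverse (real (Suc n)) \<longrightarrow> \<bar>H (f n) x' - H (f n) x\<bar> \<le> \<eta>) \<longrightarrow>
      \<bar>f n x - H (f n) x\<bar> \<le> inverse (real (Suc n)) + \<eta>)"
    by (rule choice[OF allI, THEN exE])
  then have f_B: "\<And>n. f n \<in> B" and f: "\<And>n x \<eta>. norm x \<le> real n \<Longrightarrow>
      (\<And>x'. dist x' x < inverse (real (Suc n)) \<Longrightarrow> \<bar>H (f n) x' - H (f n) x\<bar> \<le> \<eta>) \<Longrightarrow>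
      \<bar>f n x - H (f n) x\<bar> \<le> inverse (real (Suc n)) + \<eta>"
    by blast+
  have diff: "(\<lambda>n. f n x - H (f n) x) \<longlonglongrightarrow> 0" for x
  proof (rule LIMSEQ_I)
    fix \<epsilon> :: real assume \<epsilon>: "0 < \<epsilon>"
    obtain \<delta> where \<delta>: "0 < \<delta>" "\<And>x' f. dist x' x < \<delta> \<Longrightarrow> f \<in> B \<Longrightarrow> \<bar>H f x' - H f x\<bar> \<le> \<epsilon> / 2"
      using H_equicontinuous[of "\<epsilon> / 2" x] \<epsilon> by auto
    \<comment> \<open>From \<open>n1\<close> on, \<open>x\<close> lies in the controlled ball; from
      \<open>n2\<close> on, the tolerance is below both \<open>\<epsilon> / 2\<close> and the radius
      \<open>\<delta>\<close> on which \<open>H (f n)\<close> oscillates by at most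
      \<open>\<epsilon> / 2\<close>.\<close>
    obtain n1 where n1: "norm x \<le> real n1"
      using real_arch_simple by blast
    obtain n2 where n2: "inverse (real (Suc n2)) < min \<delta> (\<epsilon> / 2)"
      using reals_Archimedean[of "min \<delta> (\<epsilon> / 2)"] \<delta>(1) \<epsilon> by auto
    have "norm (f n x - H (f n) x - 0) < \<epsilon>" if "max n1 n2 \<le> n" for n
    proof -
      have "inverse (real (Suc n)) \<le> inverse (real (Suc n2))"
        using that by (intro le_imp_inverse_le) auto
      then have n: "norm x \<le> real n" "inverse (real (Suc n)) < min \<delta> (\<epsilon> / 2)"
        using that n1 n2 by linarith+
      then have "\<bar>f n x - H (f n) x\<bar> \<le> inverse (real (Suc n)) + \<epsilon> / 2"
        using \<delta>(2) f_B by (intro f) auto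
      then show ?thesis
        using n(2) by simp
    qed
    then show "\<exists>n0. \<forall>n\<ge>n0. norm (f n x - H (f n) x - 0) < \<epsilon>"
      by blast
  qed
  have bound: "norm (H (f n) x) \<le> R" for n x
    using B_D[OF H_B[OF f_B]] by simp
  have equi: "\<exists>\<delta>>0. \<forall>x'. dist x' x < \<delta> \<longrightarrow> (\<forall>n. \<bar>H (f n) x' - H (f n) x\<bar> \<le> \<epsilon>)"
    if "0 < \<epsilon>" for x \<epsilon>
    using H_equicontinuous[OF that, of x] f_B by blast
  \<comment> \<open>Equicontinuity is known for the images \<open>H (f n)\<close>, so the
    subsequence is chosen for them; \<open>diff\<close> then transfers the limit to
    \<open>f (k n)\<close>.\<close>
  obtain k l where k: "strict_mono (k :: nat \<Rightarrow> nat)"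
    and l: "\<And>x. (\<lambda>n. H (f (k n)) x) \<longlonglongrightarrow> l x" "continuous_on UNIV l"
    using equicontinuous_convergent_subsequence[of "\<lambda>n. apply_bcontfun (H (f n))", OF bound equi]
    by blast
  have "0 \<le> l x" "l x \<le> R" for x
    using l(1)[of x] B_D[OF H_B[OF f_B]] by (auto intro: LIMSEQ_le_const LIMSEQ_le_const2)
  then have l_B: "Bcontfun l \<in> B" and l_eq: "apply_bcontfun (Bcontfun l) = l"
    using l(2) by (auto intro: B_I)
  have "(\<lambda>n. f (k n) x) \<longlonglongrightarrow> l x" for x
    using tendsto_add[OF LIMSEQ_subseq_LIMSEQ[OF diff[of x] k] l(1)[of x]] by (simp add: o_def)
  then have "(\<lambda>n. H (f (k n)) x) \<longlonglongrightarrow> H (Bcontfun l) x" for x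
    using f_B l_B by (intro H_pointwise_continuous) (auto simp: l_eq)
  then have "H (Bcontfun l) x = l x" for x
    using l(1) LIMSEQ_unique by blast
  then have "H (Bcontfun l) = Bcontfun l"
    by (intro bcontfun_eqI) (simp add: l_eq)
  with l_B show ?thesis
    by blast
qed

end

section \<open>Invariance of the bound \<open>R\<close> and the resulting fixed point\<close>

theorem theorem7:
  fixes r c R :: real
    and K :: "'a::euclidean_space \<Rightarrow> 'a \<Rightarrow> real"
    and N \<zeta> :: "'a \<Rightarrow> real \<Rightarrow> real"
    and H :: "('a \<Rightarrow>\<^sub>C real) \<Rightarrow> ('a \<Rightarrow>\<^sub>C real)"
    and S :: "nat \<Rightarrow> 'a set"
  assumes r: "0 < r"
    and c: "0 < c" "c < 1"
    and S: "saturating_sequence S"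
    and K: "caratheodory_kernel K"
    and N_nonneg: "\<And>y z. 0 \<le> z \<Longrightarrow> 0 \<le> N y z"
    and H_maps: "\<And>f. f \<in> bcontfun_nonneg \<Longrightarrow> H f \<in> bcontfun_cone r c"
    and H_integrable: "\<And>f x. f \<in> bcontfun_nonneg \<Longrightarrow>
           integrable lebesgue (\<lambda>y. K x y * N y (apply_bcontfun f y))"
    and H_eq: "\<And>f x. f \<in> bcontfun_nonneg \<Longrightarrow>
           apply_bcontfun (H f) x = (LINT y|lebesgue. K x y * N y (apply_bcontfun f y))"
    and N1: "\<And>z. 0 \<le> z \<Longrightarrow> (\<lambda>y. N y z) \<in> borel_measurable lebesgue"
    and N2: "\<And>z0 \<epsilon>. 0 \<le> z0 \<Longrightarrow> 0 < \<epsilon> \<Longrightarrow>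
           \<exists>\<delta>>0. AE y in lebesgue. \<forall>z\<ge>0. \<bar>z - z0\<bar> \<le> \<delta> \<longrightarrow> \<bar>N y z - N y z0\<bar> \<le> \<epsilon>"
    and K1: "AE y in lebesgue. (\<lambda>x. K x y) \<in> apply_bcontfun ` bcontfun_cone r c"
    and zeta_cont: "continuous_on (UNIV \<times> {0..}) (\<lambda>(y, z). \<zeta> y z)"
    and zeta_nonneg: "\<And>y z. 0 \<le> z \<Longrightarrow> 0 \<le> \<zeta> y z"
    and zeta_mono: "\<And>y. mono_on {0..} (\<zeta> y)"
    and N_le_zeta: "\<And>y z. 0 \<le> z \<Longrightarrow> N y z \<le> \<zeta> y z"
    and R_pos: "0 < R"
    and R_eq: "(SUP x. \<integral>\<^sup>+y. ennreal (K x y * \<zeta> y R) \<partial>lebesgue) = ennreal R"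
    and H_chi: "\<exists>q::real. 0 < q \<and> q < 1 \<and>
           (\<forall>F. F \<subseteq> ball 0 R \<inter> bcontfun_cone r c \<longrightarrow> chi0 S (H ` F) \<le> ennreal q * chi0 S F)"
  shows "\<exists>f\<in>bcontfun_nonneg. H f = f"
proof -
  let ?B = "{f \<in> bcontfun_nonneg. \<forall>x. apply_bcontfun f x \<le> R}"
  have K_nonneg: "0 \<le> K x y" for x y
    using K unfolding caratheodory_kernel_def by blast
  have "H f \<in> ?B" if f: "f \<in> ?B" for f
  proof -
    have f_nn: "f \<in> bcontfun_nonneg" and f0: "0 \<le> apply_bcontfun f y"
      and fR: "apply_bcontfun f y \<le> R" for y
      using f by (auto simp: bcontfun_nonneg_def)
    have "apply_bcontfun (H f) x \<le> R" for x
    proof -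
      \<comment> \<open>Nonnegative integrals allow the comparison with
        \<open>K x y * \<zeta> y R\<close> before any integrability of the latter is established,
        and they match the form of \<open>R_eq\<close>.\<close>
      have "ennreal (apply_bcontfun (H f) x)
          = (\<integral>\<^sup>+y. ennreal (K x y * N y (apply_bcontfun f y)) \<partial>lebesgue)"
        unfolding H_eq[OF f_nn] using f0
        by (intro nn_integral_eq_integral[symmetric] H_integrable f_nn AE_I2 mult_nonneg_nonneg
            K_nonneg N_nonneg)
      also have "\<dots> \<le> (\<integral>\<^sup>+y. ennreal (K x y * \<zeta> y R) \<partial>lebesgue)"
      proof (intro nn_integral_mono ennreal_leI mult_left_mono K_nonneg)
        fix y
        have "N y (apply_bcontfun f y) \<le> \<zeta> y (apply_bcontfun f y)"
          using f0 by (rule N_le_zeta)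
        also have "\<dots> \<le> \<zeta> y R"
          by (rule mono_onD[OF zeta_mono]) (use f0 fR R_pos in auto)
        finally show "N y (apply_bcontfun f y) \<le> \<zeta> y R" .
      qed
      also have "\<dots> \<le> (SUP x. \<integral>\<^sup>+y. ennreal (K x y * \<zeta> y R) \<partial>lebesgue)"
        by (rule SUP_upper) simp
      finally show ?thesis
        using R_pos by (simp add: R_eq)
    qed
    then show ?thesis
      using H_maps[OF f_nn] by (simp add: bcontfun_cone_def)
  qed
  then interpret hammerstein R K N H ?B
    by unfold_locales (use R_pos in \<open>auto intro: K N_nonneg N2 H_integrable H_eq\<close>)
  show ?thesis
    using fixed_point by auto
qed

end
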